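(* Let $(X,d)$ be a metric space and let $\mathcal{S}$ be a bornology on $X$. Suppose $(A_\lambda)$ is a net in $\mathcal{P}_0(X)$ (respectively, in $CL(X)$) and $A$ is a nonempty subset (respectively, a nonempty closed subset) of $X$. Then the following statements are equivalent: (i) $(A_\lambda)$ $\mathcal{S}^+$-converges to $A$; (ii) for all $S \in \mathcal{S}$ and $\epsilon > 0$, whenever $A \cap B_d(S,\epsilon) = \emptyset$, then $A_\lambda \cap S = \emptyset$ eventually.
   Context: $\mathcal{P}_0(X)$ is the family of all nonempty subsets of $X$ and $CL(X)$ the family of all nonempty closed subsets. A bornology on $X$ is a nonempty family $\mathcal{S} \subseteq \mathcal{P}_0(X)$ that is hereditary (closed under taking nonempty subsets), closed under finite unions, and covers $X$. For $A\subseteq X$ nonempty and $\epsilon>0$, $B_d(A,\epsilon)=\{x\in X: d(x,A)<\epsilon\}$, where $d(x,A)=\inf\{d(x,a):a\in A\}$. A net $(A_\lambda)$ is $\mathcal{S}^+$-convergent (upper bornologically convergent) to $A$ if for each $\epsilon>0$ and $S\in\mathcal{S}$, eventually $A_\lambda\cap S\subseteq B_d(A,\epsilon)$. *)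

theory Defs
  imports "HOL-Analysis.Analysis"
begin

definition nonempty_subsets :: "'a set set" where
  "nonempty_subsets = {B. B \<noteq> {}}"

definition nonempty_closed_subsets :: "'a::topological_space set set" where
  "nonempty_closed_subsets = {B. B \<noteq> {} \<and> closed B}"

text \<open>Members of a bornology are nonempty by convention, so heredity only concerns nonempty
  subsets; closure under binary unions gives closure under unions of finite nonempty subfamilies.\<close>

definition bornology :: "'a set set \<Rightarrow> bool" where
  "bornology \<S> \<longleftrightarrow>
     \<S> \<noteq> {} \<and> \<S> \<subseteq> nonempty_subsets \<and>
     (\<forall>S\<in>\<S>. \<forall>T. T \<noteq> {} \<and> T \<subseteq> S \<longrightarrow> T \<in> \<S>) \<and>
     (\<forall>S\<in>\<S>. \<forall>T\<in>\<S>. S \<union> T \<in> \<S>) \<and>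
     \<Union>\<S> = UNIV"

text \<open>The library sets \<^term>\<open>infdist x {} = 0\<close>, so the enlargement is only meaningful for nonempty
  \<^term>\<open>A\<close>.\<close>

definition enlargement :: "'a::metric_space set \<Rightarrow> real \<Rightarrow> 'a set" where
  "enlargement A \<epsilon> = {x. infdist x A < \<epsilon>}"

text \<open>Nets are functions on an explicit directed index set \<^term>\<open>D\<close>, where
  \<^term>\<open>(i, j) \<in> r\<close> is read as: \<^term>\<open>j\<close> is beyond \<^term>\<open>i\<close>. The order need not be antisymmetric.\<close>

definition directed_on :: "'i set \<Rightarrow> ('i \<times> 'i) set \<Rightarrow> bool" where
  "directed_on D r \<longleftrightarrow>
     D \<noteq> {} \<and> preorder_on D r \<and> (\<forall>i\<in>D. \<forall>j\<in>D. \<exists>k\<in>D. (i, k) \<in> r \<and> (j, k) \<in> r)"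

definition net_eventually :: "'i set \<Rightarrow> ('i \<times> 'i) set \<Rightarrow> ('i \<Rightarrow> bool) \<Rightarrow> bool" where
  "net_eventually D r P \<longleftrightarrow> (\<exists>i\<in>D. \<forall>j\<in>D. (i, j) \<in> r \<longrightarrow> P j)"

definition upper_bornological_convergent ::
  "'a::metric_space set set \<Rightarrow> 'i set \<Rightarrow> ('i \<times> 'i) set \<Rightarrow> ('i \<Rightarrow> 'a set) \<Rightarrow> 'a set \<Rightarrow> bool" where
  "upper_bornological_convergent \<S> D r A\<^sub>n A \<longleftrightarrow>
     (\<forall>\<epsilon>>0. \<forall>S\<in>\<S>. net_eventually D r (\<lambda>i. A\<^sub>n i \<inter> S \<subseteq> enlargement A \<epsilon>))"

end

theory Submission
  imports Defs
begin

text \<open>For nonempty sets, \<^term>\<open>A\<close> misses the enlargement of \<^term>\<open>S\<close> iff \<^term>\<open>S\<close> misses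
  the enlargement of \<^term>\<open>A\<close>, since both say that all distances between them are at least
  \<^term>\<open>\<epsilon>\<close>. The nontrivial implication from (ii) to (i) applies (ii) to the part of \<^term>\<open>S\<close>
  outside the enlargement of \<^term>\<open>A\<close>, which by heredity is empty or again in the bornology.\<close>

text \<open>An infimum of reals that are bounded below lies strictly under \<open>\<epsilon>\<close>
  iff one of them does. Nonemptiness excludes the default value
  \<open>infdist x {} = 0\<close>.\<close>

lemma mem_enlargement_iff:
  assumes "A \<noteq> {}"
  shows "x \<in> enlargement A \<epsilon> \<longleftrightarrow> (\<exists>a\<in>A. dist x a < \<epsilon>)"
  using assms by (simp add: enlargement_def infdist_notempty cINF_less_iff)

lemma disjoint_enlargement_commute:
  assumes "A \<noteq> {}" "S \<noteq> {}"
  shows "A \<inter> enlargement S \<epsilon> = {} \<longleftrightarrow> S \<inter> enlargement A \<epsilon> = {}"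
  unfolding disjoint_iff mem_enlargement_iff[OF assms(1)] mem_enlargement_iff[OF assms(2)]
  by (metis dist_commute)

lemma net_eventually_mono:
  assumes "net_eventually D r P" "\<And>i. P i \<Longrightarrow> Q i"
  shows "net_eventually D r Q"
  using assms unfolding net_eventually_def by blast

lemma net_eventually_True:
  assumes "D \<noteq> {}"
  shows "net_eventually D r (\<lambda>i. True)"
  using assms unfolding net_eventually_def by blast

text \<open>Stated for an arbitrary family \<open>F\<close>, so that one equivalence serves both
  halves of the theorem.\<close>

lemma upper_bornological_convergent_iff_miss:
  fixes \<S> :: "'a::metric_space set set"
  assumes born: "bornology \<S>" and "D \<noteq> {}" and A: "A \<noteq> {}"
  shows "upper_bornological_convergent \<S> D r F A \<longleftrightarrow>
    (\<forall>S\<in>\<S>. \<forall>\<epsilon>>0. A \<inter> enlargement S \<epsilon> = {} \<longrightarrow> net_eventually D r (\<lambda>i. F i \<inter> S = {}))"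
    (is "?L \<longleftrightarrow> ?R")
proof
  assume L: ?L
  show ?R
  proof (intro ballI allI impI)
    fix S and \<epsilon> :: real
    assume S: "S \<in> \<S>" and "\<epsilon> > 0" and miss: "A \<inter> enlargement S \<epsilon> = {}"
    have "S \<noteq> {}"
      using born S by (auto simp: bornology_def nonempty_subsets_def)
    then have "S \<inter> enlargement A \<epsilon> = {}"
      using miss disjoint_enlargement_commute[OF A] by blast
    moreover have "net_eventually D r (\<lambda>i. F i \<inter> S \<subseteq> enlargement A \<epsilon>)"
      using L S \<open>\<epsilon> > 0\<close> by (auto simp: upper_bornological_convergent_def)
    \<comment> \<open>A point of \<open>F i \<inter> S\<close> would lie both in \<open>S\<close>
      and in \<open>enlargement A \<epsilon>\<close>, which are disjoint.\<close>
    ultimately show "net_eventually D r (\<lambda>i. F i \<inter> S = {})"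
      by (auto elim!: net_eventually_mono)
  qed
next
  assume R: ?R
  show ?L
    unfolding upper_bornological_convergent_def
  proof (intro ballI allI impI)
    fix S and \<epsilon> :: real
    assume S: "S \<in> \<S>" and "\<epsilon> > 0"
    \<comment> \<open>With this choice, \<open>F i\<close> misses \<open>T\<close> exactly when
      \<open>F i \<inter> S \<subseteq> enlargement A \<epsilon>\<close>.\<close>
    define T where "T = S - enlargement A \<epsilon>"
    have "net_eventually D r (\<lambda>i. F i \<inter> T = {})"
    \<comment> \<open>The empty set is no member of \<open>\<S>\<close>, so (ii) says nothing about
      it; but then every index of \<open>D\<close> witnesses the claim.\<close>
    proof (cases "T = {}")
      case True
      then show ?thesis
        using net_eventually_True[OF \<open>D \<noteq> {}\<close>] by simp
    next
      case False
      have "T \<subseteq> S"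
        unfolding T_def by blast
      then have "T \<in> \<S>"
        using born S False unfolding bornology_def by blast
      \<comment> \<open>\<open>T\<close> misses \<open>enlargement A \<epsilon>\<close> by
        construction; symmetry turns this into the premise of (ii), with the same
        \<open>\<epsilon>\<close>.\<close>
      moreover have "A \<inter> enlargement T \<epsilon> = {}"
        using disjoint_enlargement_commute[OF A False] unfolding T_def by blast
      ultimately show ?thesis
        using R \<open>\<epsilon> > 0\<close> by blast
    qed
    then show "net_eventually D r (\<lambda>i. F i \<inter> S \<subseteq> enlargement A \<epsilon>)"
      by (rule net_eventually_mono) (auto simp: T_def)
  qed
qed

theorem theorem6p1:
  fixes \<S> :: "'a::metric_space set set"
    and D :: "'i set" and r :: "('i \<times> 'i) set"
    and A\<^sub>n :: "'i \<Rightarrow> 'a set" and A :: "'a set"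
  assumes "bornology \<S>"
    and "directed_on D r"
  shows "((\<forall>i\<in>D. A\<^sub>n i \<in> nonempty_subsets) \<and> A \<in> nonempty_subsets \<longrightarrow>
           (upper_bornological_convergent \<S> D r A\<^sub>n A \<longleftrightarrow>
            (\<forall>S\<in>\<S>. \<forall>\<epsilon>>0. A \<inter> enlargement S \<epsilon> = {} \<longrightarrow>
               net_eventually D r (\<lambda>i. A\<^sub>n i \<inter> S = {})))) \<and>
         ((\<forall>i\<in>D. A\<^sub>n i \<in> nonempty_closed_subsets) \<and> A \<in> nonempty_closed_subsets \<longrightarrow>
           (upper_bornological_convergent \<S> D r A\<^sub>n A \<longleftrightarrow>
            (\<forall>S\<in>\<S>. \<forall>\<epsilon>>0. A \<inter> enlargement S \<epsilon> = {} \<longrightarrow>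
               net_eventually D r (\<lambda>i. A\<^sub>n i \<inter> S = {}))))"
proof -
  have "D \<noteq> {}"
    using assms(2) by (simp add: directed_on_def)
  then show ?thesis
    unfolding nonempty_subsets_def nonempty_closed_subsets_def mem_Collect_eq
    by (intro conjI impI upper_bornological_convergent_iff_miss[OF assms(1)]) simp_all
qed

end
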